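(* Let $\psi:\mathbb C^5\to\mathbb C^5$ be a polynomial map of maximal rank which preserves the polynomials $$J=y_1y_2y_3-y_4y_5,\qquad J_1=y_1+y_2+y_3-y_4,\qquad J_2=y_1+y_2+y_3-y_5$$ (i.e. $J\circ\psi=J$, $J_1\circ\psi=J_1$, $J_2\circ\psi=J_2$). Then $\psi$ is invertible and lies in the image of the $*$-Markov group.
   Context: $\mathbb C^5$ has coordinates $y=(y_1,\dots,y_5)$. A polynomial map is of maximal rank if its Jacobian matrix is invertible at some point. The $*$-Markov group is generated by elements $\lambda_{i,j}$ ($i,j\in\mathbb Z/2$), $\sigma_1,\sigma_2$, $\tau_1,\tau_2$, $\mu_{i,j}$ ($i,j\in\mathbb Z$) and acts on $\mathbb C^5$ as follows: $\lambda_{i,j}$ and $\mu_{i,j}$ act as the identity, and $\tau_1:y\mapsto(y_1,\ y_3,\ y_2+y_1y_3-y_4-y_5,\ -y_5+y_1y_3,\ -y_4+y_1y_3)$, $\tau_2:y\mapsto(y_2,\ y_1+y_2y_3-y_4-y_5,\ y_3,\ -y_5+y_2y_3,\ -y_4+y_2y_3)$, $\sigma_1:y\mapsto(y_2,y_1,y_3,y_4,y_5)$, $\sigma_2:y\mapsto(y_1,y_3,y_2,y_4,y_5)$. Thus the image of the $*$-Markov group is the group of polynomial automorphisms of $\mathbb C^5$ generated by these four maps $\tau_1,\tau_2,\sigma_1,\sigma_2$. *)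

theory Defs
  imports "HOL-Analysis.Analysis" "HOL-Algebra.Bij" "HOL-Algebra.Generated_Groups"
begin

text \<open>Polynomial functions and polynomial maps over \<open>\<complex>\<close>; since \<open>\<complex>\<close> is infinite, they are in
  bijection with formal polynomials. An exponent vector is a function \<open>m :: 'n \<Rightarrow> nat\<close>.\<close>

definition polynomial_fun :: "(complex ^ 'n \<Rightarrow> complex) \<Rightarrow> bool" where
  "polynomial_fun f \<longleftrightarrow>
     (\<exists>(M :: ('n \<Rightarrow> nat) set) (c :: ('n \<Rightarrow> nat) \<Rightarrow> complex). finite M \<and>
        (\<forall>y. f y = (\<Sum>m\<in>M. c m * (\<Prod>i\<in>UNIV. (y $ i) ^ m i))))"

definition polynomial_map :: "(complex ^ 'n \<Rightarrow> complex ^ 'm) \<Rightarrow> bool" where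
  "polynomial_map \<psi> \<longleftrightarrow> (\<forall>i. polynomial_fun (\<lambda>y. \<psi> y $ i))"

definition polynomial_automorphism :: "(complex ^ 'n \<Rightarrow> complex ^ 'n) \<Rightarrow> bool" where
  "polynomial_automorphism \<psi> \<longleftrightarrow> polynomial_map \<psi> \<and> bij \<psi> \<and> polynomial_map (inv_into UNIV \<psi>)"

text \<open>Entry \<open>(i, j)\<close> is the complex partial derivative of the \<open>i\<close>-th component in the \<open>j\<close>-th variable.\<close>

definition jacobian_matrix :: "(complex ^ 'n \<Rightarrow> complex ^ 'm) \<Rightarrow> complex ^ 'n \<Rightarrow> complex ^ 'n ^ 'm" where
  "jacobian_matrix \<psi> y = (\<chi> i j. deriv (\<lambda>t. \<psi> (y + axis j t) $ i) 0)"

definition maximal_rank :: "(complex ^ 'n \<Rightarrow> complex ^ 'n) \<Rightarrow> bool" where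
  "maximal_rank \<psi> \<longleftrightarrow> (\<exists>y. invertible (jacobian_matrix \<psi> y))"

text \<open>In the index type \<open>5\<close> the numeral \<open>5\<close> denotes the same element as \<open>0\<close>, so \<open>1, \<dots>, 5\<close>
  enumerate the type without repetition, and \<open>vector [a, b, c, d, e]\<close> lists components
  \<open>1, \<dots>, 5\<close> in this order.\<close>

definition J :: "complex ^ 5 \<Rightarrow> complex" where
  "J y = y$1 * y$2 * y$3 - y$4 * y$5"

definition J1 :: "complex ^ 5 \<Rightarrow> complex" where
  "J1 y = y$1 + y$2 + y$3 - y$4"

definition J2 :: "complex ^ 5 \<Rightarrow> complex" where
  "J2 y = y$1 + y$2 + y$3 - y$5"

definition tau1 :: "complex ^ 5 \<Rightarrow> complex ^ 5" where
  "tau1 y = vector [y$1, y$3, y$2 + y$1 * y$3 - y$4 - y$5, - y$5 + y$1 * y$3, - y$4 + y$1 * y$3]"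

definition tau2 :: "complex ^ 5 \<Rightarrow> complex ^ 5" where
  "tau2 y = vector [y$2, y$1 + y$2 * y$3 - y$4 - y$5, y$3, - y$5 + y$2 * y$3, - y$4 + y$2 * y$3]"

definition sigma1 :: "complex ^ 5 \<Rightarrow> complex ^ 5" where
  "sigma1 y = vector [y$2, y$1, y$3, y$4, y$5]"

definition sigma2 :: "complex ^ 5 \<Rightarrow> complex ^ 5" where
  "sigma2 y = vector [y$1, y$3, y$2, y$4, y$5]"

text \<open>The generators \<open>\<lambda>\<^sub>i\<^sub>,\<^sub>j\<close> and \<open>\<mu>\<^sub>i\<^sub>,\<^sub>j\<close> of the \<open>*\<close>-Markov group act as the
  identity and so contribute nothing to its image, the subgroup of the group of all permutations of
  \<open>\<complex>\<^sup>5\<close> generated by the other four. Lemma \<open>star_Markov_generators\<close> below shows that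
  these are permutations, so that \<^const>\<open>generate\<close> indeed adjoins their inverses.\<close>

definition star_Markov_image :: "(complex ^ 5 \<Rightarrow> complex ^ 5) set" where
  "star_Markov_image = generate (BijGroup UNIV) {tau1, tau2, sigma1, sigma2}"

lemma exhaust_5: "x = 1 \<or> x = 2 \<or> x = 3 \<or> x = 4 \<or> x = 5" for x :: 5
proof (induct x)
  case (of_int z)
  then have "z = 0 \<or> z = 1 \<or> z = 2 \<or> z = 3 \<or> z = 4" by auto
  then show ?case by auto
qed

lemma forall_5: "(\<forall>i::5. P i) \<longleftrightarrow> P 1 \<and> P 2 \<and> P 3 \<and> P 4 \<and> P 5"
  by (metis exhaust_5)

lemma vector_5 [simp]:
  "(vector [a, b, c, d, e] :: 'a::zero ^ 5) $ 1 = a"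
  "(vector [a, b, c, d, e] :: 'a ^ 5) $ 2 = b"
  "(vector [a, b, c, d, e] :: 'a ^ 5) $ 3 = c"
  "(vector [a, b, c, d, e] :: 'a ^ 5) $ 4 = d"
  "(vector [a, b, c, d, e] :: 'a ^ 5) $ 5 = e"
  by (simp_all add: vector_def)

lemma star_Markov_generators: "{tau1, tau2, sigma1, sigma2} \<subseteq> carrier (BijGroup UNIV)"
proof -
  have "bij tau1"
    by (rule o_bij[of "\<lambda>z. vector [z$1, z$3 + z$1 * z$2 - z$4 - z$5, z$2, z$1 * z$2 - z$5, z$1 * z$2 - z$4]"])
      (auto simp: fun_eq_iff tau1_def vec_eq_iff forall_5)
  moreover have "bij tau2"
    by (rule o_bij[of "\<lambda>z. vector [z$2 + z$1 * z$3 - z$4 - z$5, z$1, z$3, z$1 * z$3 - z$5, z$1 * z$3 - z$4]"])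
      (auto simp: fun_eq_iff tau2_def vec_eq_iff forall_5)
  moreover have "bij sigma1"
    by (rule o_bij[of sigma1]) (auto simp: fun_eq_iff sigma1_def vec_eq_iff forall_5)
  moreover have "bij sigma2"
    by (rule o_bij[of sigma2]) (auto simp: fun_eq_iff sigma2_def vec_eq_iff forall_5)
  ultimately show ?thesis by (simp add: BijGroup_def Bij_def)
qed

end

theory Submission
  imports Defs
begin

text \<open>Let \<open>f\<close>, \<open>g\<close>, \<open>h\<close> be the first three components of \<open>\<psi>\<close>. Invariance of \<open>J1\<close> and \<open>J2\<close> determines the
  other two as \<open>f + g + h - J1\<close> and \<open>f + g + h - J2\<close>, so invariance of \<open>J\<close> becomes a Markov-type cubic equation
  \<open>f g h - (f + g + h - J1) (f + g + h - J2) = J\<close>, whose right-hand side has degree 3. The proof is a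
  descent on the sum of the total degrees of \<open>f\<close>, \<open>g\<close>, \<open>h\<close>, none of which is constant.

  Permute the components by \<open>sigma1\<close> and \<open>sigma2\<close> so that \<open>h\<close> has the largest degree. If
  \<open>deg f + deg g > deg h\<close>, the product \<open>f g h\<close> dominates the left-hand side, the degrees add up to at most 3, and all
  three are 1. Otherwise the dominant terms are \<open>f g h\<close> and \<open>h\<^sup>2\<close>; they must cancel, which means
  \<open>deg (f g - h) < deg h\<close>. Then passing to the other root of the equation, read as a quadratic
  in \<open>h\<close>, lowers the degree. This change of root is \<open>tau1 \<circ> sigma2\<close>, an involution in the group (lemmas
  \<open>cubic_degree_dichotomy\<close> and \<open>vieta_lowers_degree\<close>).

  When the descent stops, \<open>f\<close>, \<open>g\<close>, \<open>h\<close> are affine. The product of their linear parts is \<open>y\<^sub>1 y\<^sub>2 y\<^sub>3\<close>, so up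
  to a permutation each depends on a single coordinate, and the equation then leaves only the identity (lemmas
  \<open>affine_Markov_map_component\<close> and \<open>diagonal_Markov_map_id\<close>).

  Total degrees are measured on lines through the origin: along such a line a polynomial
  function is a univariate polynomial, and on a generic line its degree is the total degree. Maximal
  rank is used only to see that no component becomes constant during the descent: by the open mapping property the
  range has an interior point, and this is inherited when a homeomorphism is applied.\<close>

section \<open>The ring of polynomial functions\<close>

lemma polynomial_fun_monomial_sum:
  fixes c :: "'b \<Rightarrow> complex" and e :: "'b \<Rightarrow> 'n::finite \<Rightarrow> nat"
  assumes "finite I"
  shows "polynomial_fun (\<lambda>y::complex^'n. \<Sum>i\<in>I. c i * (\<Prod>j\<in>UNIV. (y $ j) ^ e i j))"
  unfolding polynomial_fun_def
proof (intro exI conjI allI)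
  show "finite (e ` I)" using assms by simp
  fix y :: "complex^'n"
  have "(\<Sum>i\<in>I. c i * (\<Prod>j\<in>UNIV. (y $ j) ^ e i j)) =
      (\<Sum>m\<in>e ` I. \<Sum>i\<in>{i\<in>I. e i = m}. c i * (\<Prod>j\<in>UNIV. (y $ j) ^ e i j))"
    by (rule sum.image_gen[OF assms])
  also have "\<dots> = (\<Sum>m\<in>e ` I. (\<Sum>i\<in>{i\<in>I. e i = m}. c i) * (\<Prod>j\<in>UNIV. (y $ j) ^ m j))"
    unfolding sum_distrib_right by (intro sum.cong refl) auto
  finally show "(\<Sum>i\<in>I. c i * (\<Prod>j\<in>UNIV. (y $ j) ^ e i j)) =
      (\<Sum>m\<in>e ` I. (\<Sum>i\<in>{i\<in>I. e i = m}. c i) * (\<Prod>j\<in>UNIV. (y $ j) ^ m j))" .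
qed

lemma polynomial_fun_const [intro, simp]: "polynomial_fun (\<lambda>y::complex^'n::finite. k)"
  using polynomial_fun_monomial_sum[of "{()}" "\<lambda>_. k" "\<lambda>_ _. 0"] by simp

lemma polynomial_fun_nth [intro, simp]: "polynomial_fun (\<lambda>y::complex^'n::finite. y $ i)"
proof -
  have "(\<Prod>j\<in>UNIV. (y $ j) ^ (if j = i then 1 else 0)) = y $ i" for y :: "complex^'n"
    by (subst prod.remove[of _ i]) (auto intro: prod.neutral)
  then show ?thesis
    using polynomial_fun_monomial_sum[of "{()}" "\<lambda>_. 1" "\<lambda>_ j. if j = i then 1 else 0"] by simp
qed

lemma polynomial_fun_add [intro]:
  fixes f g :: "complex^'n::finite \<Rightarrow> complex"
  assumes "polynomial_fun f" "polynomial_fun g"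
  shows "polynomial_fun (\<lambda>y. f y + g y)"
proof -
  obtain M c where M: "finite M" "\<And>y. f y = (\<Sum>m\<in>M. c m * (\<Prod>i\<in>UNIV. (y $ i) ^ m i))"
    using assms(1) unfolding polynomial_fun_def by blast
  obtain N d where N: "finite N" "\<And>y. g y = (\<Sum>m\<in>N. d m * (\<Prod>i\<in>UNIV. (y $ i) ^ m i))"
    using assms(2) unfolding polynomial_fun_def by blast
  have "polynomial_fun (\<lambda>y. \<Sum>i\<in>M <+> N. case_sum c d i * (\<Prod>j\<in>UNIV. (y $ j) ^ case_sum id id i j))"
    using M(1) N(1) by (intro polynomial_fun_monomial_sum) simp
  then show ?thesis by (simp add: M N sum.Plus)
qed

lemma polynomial_fun_mult [intro]:
  fixes f g :: "complex^'n::finite \<Rightarrow> complex"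
  assumes "polynomial_fun f" "polynomial_fun g"
  shows "polynomial_fun (\<lambda>y. f y * g y)"
proof -
  obtain M c where M: "finite M" "\<And>y. f y = (\<Sum>m\<in>M. c m * (\<Prod>i\<in>UNIV. (y $ i) ^ m i))"
    using assms(1) unfolding polynomial_fun_def by blast
  obtain N d where N: "finite N" "\<And>y. g y = (\<Sum>m\<in>N. d m * (\<Prod>i\<in>UNIV. (y $ i) ^ m i))"
    using assms(2) unfolding polynomial_fun_def by blast
  have "f y * g y = (\<Sum>p\<in>M \<times> N. (c (fst p) * d (snd p)) *
      (\<Prod>j\<in>UNIV. (y $ j) ^ (fst p j + snd p j)))" for y
    unfolding M N sum_product sum.cartesian_product
    by (intro sum.cong refl) (auto simp: power_add prod.distrib)
  moreover have "polynomial_fun (\<lambda>y::complex^'n. \<Sum>p\<in>M \<times> N. (c (fst p) * d (snd p)) *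
      (\<Prod>j\<in>UNIV. (y $ j) ^ (fst p j + snd p j)))"
    using M(1) N(1) by (intro polynomial_fun_monomial_sum) simp
  ultimately show ?thesis by simp
qed

lemma polynomial_fun_diff [intro]:
  fixes f g :: "complex^'n::finite \<Rightarrow> complex"
  assumes "polynomial_fun f" "polynomial_fun g"
  shows "polynomial_fun (\<lambda>y. f y - g y)"
  using polynomial_fun_add[OF assms(1) polynomial_fun_mult[OF polynomial_fun_const[of "-1"] assms(2)]]
  by simp

lemma polynomial_fun_sum [intro]:
  fixes f :: "'b \<Rightarrow> complex^'n::finite \<Rightarrow> complex"
  assumes "\<And>i. i \<in> I \<Longrightarrow> polynomial_fun (f i)"
  shows "polynomial_fun (\<lambda>y. \<Sum>i\<in>I. f i y)"
  using assms by (induction I rule: infinite_finite_induct) auto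

text \<open>Everything needed about the analytic and algebraic behaviour of polynomial functions is stable
  under sums and products, so it is enough to check it on constants and coordinates.\<close>

lemma polynomial_fun_induct [consumes 1, case_names const nth add mult]:
  fixes f :: "complex^'n::finite \<Rightarrow> complex"
  assumes f: "polynomial_fun f"
    and const: "\<And>k. P (\<lambda>y. k)"
    and nth: "\<And>i. P (\<lambda>y. y $ i)"
    and add: "\<And>f g. polynomial_fun f \<Longrightarrow> polynomial_fun g \<Longrightarrow> P f \<Longrightarrow> P g \<Longrightarrow> P (\<lambda>y. f y + g y)"
    and mult: "\<And>f g. polynomial_fun f \<Longrightarrow> polynomial_fun g \<Longrightarrow> P f \<Longrightarrow> P g \<Longrightarrow> P (\<lambda>y. f y * g y)"
  shows "P f"
proof -
  let ?Q = "\<lambda>f. polynomial_fun f \<and> P f"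
  obtain M c where M: "finite M" "f = (\<lambda>y. \<Sum>m\<in>M. c m * (\<Prod>i\<in>UNIV. (y $ i) ^ m i))"
    using f unfolding polynomial_fun_def by blast
  have power: "?Q (\<lambda>y. (y $ i) ^ k)" for i k
    by (induction k) (auto intro: const nth mult)
  have "?Q (\<lambda>y. \<Prod>i\<in>S. (y $ i) ^ m i)" for S and m :: "'n \<Rightarrow> nat"
  proof (induction S rule: infinite_finite_induct)
    case (insert i S)
    then show ?case using power[of i "m i"] by (auto intro: mult)
  qed (auto intro: const)
  then have monomial: "?Q (\<lambda>y. c m * (\<Prod>i\<in>UNIV. (y $ i) ^ m i))" for m
    by (auto intro: mult const)
  have "?Q (\<lambda>y. \<Sum>m\<in>M. c m * (\<Prod>i\<in>UNIV. (y $ i) ^ m i))"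
    using \<open>finite M\<close>
  proof induction
    case (insert m M)
    then show ?case using monomial[of m] by (auto intro: add)
  qed (auto intro: const)
  then show ?thesis using M by simp
qed

lemma polynomial_fun_compose:
  fixes f :: "complex^'m::finite \<Rightarrow> complex" and \<phi> :: "complex^'n::finite \<Rightarrow> complex^'m"
  assumes "polynomial_fun f" "polynomial_map \<phi>"
  shows "polynomial_fun (\<lambda>y. f (\<phi> y))"
  using assms(1)
proof (induction rule: polynomial_fun_induct)
  case (nth i)
  then show ?case using assms(2) by (simp add: polynomial_map_def)
qed auto

lemma polynomial_map_compose:
  fixes \<phi> :: "complex^'m::finite \<Rightarrow> complex^'l::finite" and \<psi> :: "complex^'n::finite \<Rightarrow> complex^'m"
  assumes "polynomial_map \<phi>" "polynomial_map \<psi>"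
  shows "polynomial_map (\<phi> \<circ> \<psi>)"
  using assms by (auto simp: polynomial_map_def[of "\<phi> \<circ> \<psi>"] polynomial_map_def[of \<phi>]
      intro: polynomial_fun_compose)

lemma polynomial_automorphism_compose:
  fixes \<phi> \<psi> :: "complex^'n::finite \<Rightarrow> complex^'n"
  assumes "polynomial_automorphism \<phi>" "polynomial_automorphism \<psi>"
  shows "polynomial_automorphism (\<phi> \<circ> \<psi>)"
  using assms
  by (auto simp: polynomial_automorphism_def o_inv_distrib intro: polynomial_map_compose bij_comp)

lemma polynomial_automorphism_involution:
  fixes \<phi> :: "complex^'n::finite \<Rightarrow> complex^'n"
  assumes "polynomial_map \<phi>" "\<phi> \<circ> \<phi> = id"
  shows "polynomial_automorphism \<phi>"
proof -
  have "bij \<phi>" using assms(2) o_bij by blast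
  moreover have "inv_into UNIV \<phi> = \<phi>" using assms(2) inv_unique_comp by blast
  ultimately show ?thesis using assms(1) by (simp add: polynomial_automorphism_def)
qed

section \<open>Derivatives and maximal rank\<close>

lemma polynomial_fun_has_derivative:
  fixes f :: "complex^'n::finite \<Rightarrow> complex"
  assumes "polynomial_fun f"
  obtains D where "(f has_derivative D) (at y)" "\<And>c h. D (c *s h) = c * D h"
proof -
  have "\<exists>D. (f has_derivative D) (at y) \<and> (\<forall>c h. D (c *s h) = c * D h)"
    using assms
  proof (induction rule: polynomial_fun_induct)
    case (const k)
    show ?case by (intro exI[of _ "\<lambda>h. 0"]) auto
  next
    case (nth i)
    show ?case
      by (intro exI[of _ "\<lambda>h. h $ i"])
        (auto intro: bounded_linear_imp_has_derivative bounded_linear_vec_nth)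
  next
    case (add f g)
    then obtain D E where "(f has_derivative D) (at y)" "\<forall>c h. D (c *s h) = c * D h"
      "(g has_derivative E) (at y)" "\<forall>c h. E (c *s h) = c * E h" by blast
    then show ?case
      by (intro exI[of _ "\<lambda>h. D h + E h"]) (auto intro: has_derivative_add simp: distrib_left)
  next
    case (mult f g)
    then obtain D E where "(f has_derivative D) (at y)" "\<forall>c h. D (c *s h) = c * D h"
      "(g has_derivative E) (at y)" "\<forall>c h. E (c *s h) = c * E h" by blast
    then show ?case
      by (intro exI[of _ "\<lambda>h. f y * E h + D h * g y"] conjI has_derivative_mult)
        (auto simp: algebra_simps)
  qed
  then show ?thesis using that by blast
qed

lemma complex_linear_expansion:
  fixes D :: "complex^'n::finite \<Rightarrow> complex"
  assumes "linear D" "\<And>c h. D (c *s h) = c * D h"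
  shows "D h = (\<Sum>i\<in>UNIV. h $ i * D (axis i 1))"
proof -
  have "D h = D (\<Sum>i\<in>UNIV. h $ i *s axis i 1)" by (simp only: basis_expansion)
  also have "\<dots> = (\<Sum>i\<in>UNIV. D (h $ i *s axis i 1))" by (rule linear_sum[OF assms(1)])
  finally show ?thesis by (simp only: assms(2))
qed

lemma polynomial_map_has_derivative_jacobian:
  fixes \<psi> :: "complex^'n::finite \<Rightarrow> complex^'m::finite"
  assumes "polynomial_map \<psi>"
  shows "(\<psi> has_derivative (\<lambda>h. jacobian_matrix \<psi> y *v h)) (at y)"
proof -
  have comp: "((\<lambda>x. \<psi> x $ i) has_derivative (\<lambda>h. (jacobian_matrix \<psi> y *v h) $ i)) (at y)" for i
  proof -
    have "polynomial_fun (\<lambda>x. \<psi> x $ i)" using assms by (simp add: polynomial_map_def)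
    then obtain D where D: "((\<lambda>x. \<psi> x $ i) has_derivative D) (at y)"
      and hom: "\<And>c h. D (c *s h) = c * D h"
      using polynomial_fun_has_derivative by blast
    have partial: "jacobian_matrix \<psi> y $ i $ j = D (axis j 1)" for j
    proof -
      have "axis j t = t *s axis j (1::complex)" for t
        by (simp add: vec_eq_iff axis_def)
      then have D_axis: "D (axis j t) = D (axis j 1) * t" for t
        by (metis hom mult.commute)
      have "bounded_linear (\<lambda>t. axis j t :: complex^'n)"
        by (intro linear_conv_bounded_linear[THEN iffD1] linearI)
          (auto simp: vec_eq_iff axis_def)
      then have "((\<lambda>t. y + axis j t) has_derivative axis j) (at 0)"
        by (auto intro!: derivative_eq_intros bounded_linear_imp_has_derivative)
      moreover have "((\<lambda>x. \<psi> x $ i) has_derivative D) (at (y + axis j 0))"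
        using D by (simp add: axis_def zero_vec_def[symmetric])
      ultimately have "((\<lambda>t. \<psi> (y + axis j t) $ i) has_derivative (\<lambda>t. D (axis j t))) (at 0)"
        by (rule has_derivative_compose)
      then have "((\<lambda>t. \<psi> (y + axis j t) $ i) has_field_derivative D (axis j 1)) (at 0)"
        unfolding has_field_derivative_def
        by (rule has_derivative_eq_rhs) (rule ext, rule D_axis)
      then show ?thesis by (simp add: jacobian_matrix_def DERIV_imp_deriv)
    qed
    have "D h = (jacobian_matrix \<psi> y *v h) $ i" for h
      using complex_linear_expansion[OF has_derivative_linear[OF D] hom, of h]
      by (simp add: matrix_vector_mult_def partial mult.commute)
    then have "D = (\<lambda>h. (jacobian_matrix \<psi> y *v h) $ i)" by auto
    then show ?thesis using D by simp
  qed
  have "((\<lambda>x. \<psi> x \<bullet> b) has_derivative (\<lambda>h. (jacobian_matrix \<psi> y *v h) \<bullet> b)) (at y)"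
    if b: "b \<in> Basis" for b
  proof -
    obtain i u where "b = axis i u" using b by (auto simp: Basis_vec_def)
    then show ?thesis by (simp only: inner_axis) (rule has_derivative_inner_left, rule comp)
  qed
  then show ?thesis using has_derivative_componentwise_within by blast
qed

lemma polynomial_map_continuous:
  fixes \<psi> :: "complex^'n::finite \<Rightarrow> complex^'m::finite"
  assumes "polynomial_map \<psi>"
  shows "continuous_on UNIV \<psi>"
  by (rule has_derivative_continuous_on)
    (rule has_derivative_at_withinI[OF polynomial_map_has_derivative_jacobian[OF assms]])

text \<open>Having interior points in the range is the form in which maximal rank is used: it visibly survives
  composition with homeomorphisms, and it forbids constant components.\<close>

lemma maximal_rank_interior_range:
  fixes \<psi> :: "complex^'n::finite \<Rightarrow> complex^'n"
  assumes "polynomial_map \<psi>" "maximal_rank \<psi>"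
  shows "interior (range \<psi>) \<noteq> {}"
proof -
  obtain y B where B: "jacobian_matrix \<psi> y ** B = mat 1"
    using assms(2) unfolding maximal_rank_def invertible_def by blast
  have "\<psi> y \<in> interior (\<psi> ` UNIV)"
  proof (rule sussmann_open_mapping)
    show "(\<psi> has_derivative (\<lambda>h. jacobian_matrix \<psi> y *v h)) (at y)"
      by (rule polynomial_map_has_derivative_jacobian[OF assms(1)])
    show "bounded_linear ((*v) B)"
      by (intro linear_conv_bounded_linear[THEN iffD1] linearI)
        (auto simp: matrix_vector_right_distrib vec_eq_iff matrix_vector_mult_def scaleR_sum_right
          sum.distrib[symmetric] distrib_left)
    show "(\<lambda>h. jacobian_matrix \<psi> y *v h) \<circ> (*v) B = id"
      by (auto simp: fun_eq_iff matrix_vector_mul_assoc B)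
  qed (use polynomial_map_continuous[OF assms(1)] in auto)
  then show ?thesis by auto
qed

lemma interior_range_compose_homeomorphism:
  fixes \<phi> \<psi> :: "complex^'n::finite \<Rightarrow> complex^'n"
  assumes "interior (range \<psi>) \<noteq> {}" "polynomial_automorphism \<phi>"
  shows "interior (range (\<phi> \<circ> \<psi>)) \<noteq> {}"
proof -
  have "bij \<phi>" and cont: "continuous_on UNIV (inv_into UNIV \<phi>)"
    using assms(2) polynomial_map_continuous by (auto simp: polynomial_automorphism_def)
  have "open (inv_into UNIV \<phi> -` interior (range \<psi>))"
    by (rule open_vimage[OF open_interior cont])
  then have "open (\<phi> ` interior (range \<psi>))"
    unfolding bij_vimage_eq_inv_image[OF bij_imp_bij_inv[OF \<open>bij \<phi>\<close>]] inv_inv_eq[OF \<open>bij \<phi>\<close>] .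
  moreover have "\<phi> ` interior (range \<psi>) \<subseteq> range (\<phi> \<circ> \<psi>)"
    using interior_subset by fastforce
  ultimately have "\<phi> ` interior (range \<psi>) \<subseteq> interior (range (\<phi> \<circ> \<psi>))"
    by (rule interior_maximal[rotated])
  then show ?thesis using assms(1) by blast
qed

lemma interior_range_component_nonconstant:
  fixes \<psi> :: "'b \<Rightarrow> complex^'n::finite"
  assumes ne: "interior (range \<psi>) \<noteq> {}"
  shows "\<not> (\<forall>y. \<psi> y $ i = k)"
proof
  assume const: "\<forall>y. \<psi> y $ i = k"
  obtain p e where "e > 0" and ball: "ball p e \<subseteq> range \<psi>"
    using assms mem_interior by blast
  let ?q = "p + axis i (of_real (e/2))"
  have "norm (axis i x :: complex ^ 'n) = norm x" for x :: complex
    unfolding norm_eq_sqrt_inner by (simp add: inner_axis_axis)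
  then have "?q \<in> ball p e" "p \<in> ball p e"
    using \<open>e > 0\<close> by (simp_all add: dist_norm)
  then have "?q \<in> range \<psi>" "p \<in> range \<psi>" using ball by blast+
  then have "?q $ i = p $ i" using const by (metis rangeE)
  then show False using \<open>e > 0\<close> by simp
qed

section \<open>Rays and total degree\<close>

text \<open>The restriction of a polynomial function to the line through the origin and \<open>y\<close>; its coefficients are the
  values at \<open>y\<close> of the homogeneous components.\<close>

definition ray_poly :: "(complex^'n \<Rightarrow> complex) \<Rightarrow> complex^'n \<Rightarrow> complex poly" where
  "ray_poly f y = (THE p. \<forall>t. poly p t = f (t *s y))"

lemma poly_eqI_all:
  fixes p q :: "complex poly"
  assumes "\<And>t. poly p t = poly q t"
  shows "p = q"
  using poly_eq_poly_eq_iff[of p q] assms by (simp add: fun_eq_iff)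

lemma ray_poly_eqI:
  assumes "\<And>t. poly p t = f (t *s y)"
  shows "ray_poly f y = p"
  unfolding ray_poly_def
proof (rule the_equality)
  fix q assume "\<forall>t. poly q t = f (t *s y)"
  then have "poly q = poly p" using assms by auto
  then show "q = p" by (simp add: poly_eq_poly_eq_iff)
qed (use assms in auto)

lemma ray_poly_family:
  fixes f :: "complex^'n::finite \<Rightarrow> complex"
  assumes "polynomial_fun f"
  obtains p N where "\<And>y t. poly (p y) t = f (t *s y)"
    "\<And>k. polynomial_fun (\<lambda>y. coeff (p y) k)" "\<And>y. degree (p y) \<le> N"
proof -
  have "\<exists>p N. (\<forall>y t. poly (p y) t = f (t *s y)) \<and> (\<forall>k. polynomial_fun (\<lambda>y. coeff (p y) k)) \<and>
      (\<forall>y. degree (p y) \<le> N)"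
    using assms
  proof (induction rule: polynomial_fun_induct)
    case (const k)
    show ?case by (intro exI[of _ "\<lambda>y. [:k:]"] exI[of _ 0]) auto
  next
    case (nth i)
    have "coeff [:0, y $ i:] k = (if k = 1 then y $ i else 0)" for k and y :: "complex^'n"
      by (simp add: coeff_pCons split: nat.split)
    then have "polynomial_fun (\<lambda>y. coeff [:0, y $ i:] k)" for k
      by (cases "k = 1") auto
    then show ?case
      by (intro exI[of _ "\<lambda>y. [:0, y $ i:]"] exI[of _ 1]) auto
  next
    case (add f g)
    obtain p N where p: "\<forall>y t. poly (p y) t = f (t *s y)"
      "\<forall>k. polynomial_fun (\<lambda>y. coeff (p y) k)" "\<forall>y. degree (p y) \<le> N" using add.IH(1) by blast
    obtain q K where q: "\<forall>y t. poly (q y) t = g (t *s y)"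
      "\<forall>k. polynomial_fun (\<lambda>y. coeff (q y) k)" "\<forall>y. degree (q y) \<le> K" using add.IH(2) by blast
    show ?case
      using p q by (intro exI[of _ "\<lambda>y. p y + q y"] exI[of _ "max N K"])
        (auto intro!: degree_add_le intro: le_max_iff_disj[THEN iffD2])
  next
    case (mult f g)
    obtain p N where p: "\<forall>y t. poly (p y) t = f (t *s y)"
      "\<forall>k. polynomial_fun (\<lambda>y. coeff (p y) k)" "\<forall>y. degree (p y) \<le> N" using mult.IH(1) by blast
    obtain q K where q: "\<forall>y t. poly (q y) t = g (t *s y)"
      "\<forall>k. polynomial_fun (\<lambda>y. coeff (q y) k)" "\<forall>y. degree (q y) \<le> K" using mult.IH(2) by blast
    have "degree (p y * q y) \<le> N + K" for y
      using degree_mult_le[of "p y" "q y"] p(3) q(3) by (meson add_mono order_trans)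
    then show ?case
      using p q by (intro exI[of _ "\<lambda>y. p y * q y"] exI[of _ "N + K"]) (auto simp: coeff_mult intro!: polynomial_fun_sum polynomial_fun_mult)
  qed
  then show ?thesis using that by blast
qed

lemma poly_ray_poly:
  fixes f :: "complex^'n::finite \<Rightarrow> complex"
  assumes "polynomial_fun f"
  shows "poly (ray_poly f y) t = f (t *s y)"
  using ray_poly_family[OF assms] ray_poly_eqI by metis

lemma polynomial_fun_coeff_ray_poly:
  fixes f :: "complex^'n::finite \<Rightarrow> complex"
  assumes "polynomial_fun f"
  shows "polynomial_fun (\<lambda>y. coeff (ray_poly f y) k)"
proof -
  obtain p N where p: "\<And>y t. poly (p y) t = f (t *s y)"
    "\<And>k. polynomial_fun (\<lambda>y. coeff (p y) k)" "\<And>y. degree (p y) \<le> N"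
    using ray_poly_family[OF assms] by metis
  then have "ray_poly f = p" using ray_poly_eqI by blast
  then show ?thesis using p by simp
qed

lemma finite_degrees_ray_poly:
  fixes f :: "complex^'n::finite \<Rightarrow> complex"
  assumes "polynomial_fun f"
  shows "finite (range (\<lambda>y. degree (ray_poly f y)))"
proof -
  obtain p N where p: "\<And>y t. poly (p y) t = f (t *s y)"
    "\<And>k. polynomial_fun (\<lambda>y. coeff (p y) k)" "\<And>y. degree (p y) \<le> N"
    using ray_poly_family[OF assms] by metis
  then have "ray_poly f = p" using ray_poly_eqI by blast
  then show ?thesis using p(3) by (auto intro: finite_subset[of _ "{..N}"])
qed

text \<open>A line through points where two polynomial functions do not vanish carries two nonzero univariate
  polynomials, and \<open>\<complex>\<close> is infinite.\<close>

lemma polynomial_fun_no_zero_divisors: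
  fixes f g :: "complex^'n::finite \<Rightarrow> complex"
  assumes "polynomial_fun f" "polynomial_fun g" "f u \<noteq> 0" "g v \<noteq> 0"
  obtains y where "f y \<noteq> 0" "g y \<noteq> 0"
proof -
  have shift: "polynomial_map (\<lambda>y. u + y)"
    by (auto simp: polynomial_map_def)
  define p where "p = ray_poly (\<lambda>y. f (u + y)) (v - u)"
  define q where "q = ray_poly (\<lambda>y. g (u + y)) (v - u)"
  have p: "poly p t = f (u + t *s (v - u))" for t
    unfolding p_def by (rule poly_ray_poly[OF polynomial_fun_compose[OF assms(1) shift]])
  have q: "poly q t = g (u + t *s (v - u))" for t
    unfolding q_def by (rule poly_ray_poly[OF polynomial_fun_compose[OF assms(2) shift]])
  have "poly p 0 \<noteq> 0" "poly q 1 \<noteq> 0" using p[of 0] q[of 1] assms by simp_all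
  then have "p * q \<noteq> 0" by auto
  then obtain t where "poly (p * q) t \<noteq> 0" using poly_all_0_iff_0 by blast
  then show ?thesis using that[of "u + t *s (v - u)"] p q by simp
qed

lemma polynomial_fun_common_nonzero:
  fixes S :: "(complex^'n::finite \<Rightarrow> complex) set"
  assumes "finite S" "\<And>f. f \<in> S \<Longrightarrow> polynomial_fun f" "\<And>f. f \<in> S \<Longrightarrow> \<exists>y. f y \<noteq> 0"
  shows "\<exists>y. \<forall>f\<in>S. f y \<noteq> 0"
proof -
  have "polynomial_fun (\<lambda>y. \<Prod>f\<in>S. f y) \<and> (\<exists>y. (\<Prod>f\<in>S. f y) \<noteq> 0)"
    using assms
  proof induction
    case (insert f S)
    then obtain u v where uv: "f u \<noteq> 0" "(\<Prod>f\<in>S. f v) \<noteq> 0" by blast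
    have pf: "polynomial_fun f" "polynomial_fun (\<lambda>y. \<Prod>f\<in>S. f y)" using insert by blast+
    obtain y where "f y \<noteq> 0" "(\<Prod>f\<in>S. f y) \<noteq> 0"
      using polynomial_fun_no_zero_divisors[OF pf uv] by blast
    then have "(\<Prod>f\<in>insert f S. f y) \<noteq> 0" using insert.hyps by simp
    then show ?case using pf insert.hyps by auto
  qed auto
  then show ?thesis using assms(1) by auto
qed

definition total_degree :: "(complex^'n::finite \<Rightarrow> complex) \<Rightarrow> nat" where
  "total_degree f = Max (range (\<lambda>y. degree (ray_poly f y)))"

lemma degree_ray_poly_le:
  "polynomial_fun f \<Longrightarrow> degree (ray_poly f y) \<le> total_degree f"
  unfolding total_degree_def by (simp add: Max_ge finite_degrees_ray_poly)

lemma total_degree_attained: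
  assumes "polynomial_fun f"
  obtains y where "degree (ray_poly f y) = total_degree f"
  using Max_in[OF finite_degrees_ray_poly[OF assms]] that unfolding total_degree_def by fastforce

text \<open>The directions in which a given polynomial function fails to attain its total degree are the zeros of a
  nonzero polynomial function, so finitely many functions attain theirs simultaneously.\<close>

lemma total_degree_attained_simultaneously:
  fixes S :: "(complex^'n::finite \<Rightarrow> complex) set"
  assumes "finite S" "\<And>f. f \<in> S \<Longrightarrow> polynomial_fun f"
  obtains y where "\<And>f. f \<in> S \<Longrightarrow> degree (ray_poly f y) = total_degree f"
proof -
  let ?lead = "\<lambda>f y. coeff (ray_poly f y) (total_degree f)"
  let ?S = "{f\<in>S. total_degree f > 0}"
  have "\<exists>y. \<forall>g\<in>?lead ` ?S. g y \<noteq> 0"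
  proof (rule polynomial_fun_common_nonzero)
    fix g assume "g \<in> ?lead ` ?S"
    then obtain f where f: "f \<in> S" "total_degree f > 0" and g: "g = ?lead f" by blast
    show "polynomial_fun g" using g f assms(2) polynomial_fun_coeff_ray_poly by blast
    obtain y where y: "degree (ray_poly f y) = total_degree f"
      using total_degree_attained assms(2) f by blast
    then have "ray_poly f y \<noteq> 0" using f by auto
    then show "\<exists>y. g y \<noteq> 0" using y g by (metis leading_coeff_0_iff)
  qed (use assms in auto)
  then obtain y where y: "\<forall>g\<in>?lead ` ?S. g y \<noteq> 0" by (rule exE)
  have "degree (ray_poly f y) = total_degree f" if "f \<in> S" for f
  proof (cases "total_degree f = 0")
    case True
    then show ?thesis using degree_ray_poly_le[of f y] assms(2) that by simp
  next
    case False
    then have "?lead f y \<noteq> 0" using bspec[OF y imageI[of f]] that by simp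
    then have "degree (ray_poly f y) \<ge> total_degree f" by (rule le_degree)
    then show ?thesis using degree_ray_poly_le[of f y] assms(2) that by (simp add: le_antisym)
  qed
  then show ?thesis using that by blast
qed

lemma total_degree_0_imp_constant:
  assumes "polynomial_fun f" "total_degree f = 0"
  shows "f y = f 0"
proof -
  have "degree (ray_poly f y) = 0" using degree_ray_poly_le[OF assms(1), of y] assms(2) by simp
  then have "poly (ray_poly f y) 1 = poly (ray_poly f y) 0" by (metis degree_eq_zeroE poly_pCons poly_0 mult_zero_right)
  then show ?thesis by (simp add: poly_ray_poly[OF assms(1)])
qed

text \<open>Along every ray the function is affine, hence equal to its first-order Taylor polynomial at the
  origin; the derivative there is linear.\<close>

lemma total_degree_le_1_imp_affine:
  fixes f :: "complex^'n::finite \<Rightarrow> complex"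
  assumes f: "polynomial_fun f" and deg: "total_degree f \<le> 1"
  obtains D where "linear D" "\<And>c h. D (c *s h) = c * D h" "\<And>y. f y = f 0 + D y"
proof -
  obtain D where D: "(f has_derivative D) (at 0)" and hom: "\<And>c h. D (c *s h) = c * D h"
    using polynomial_fun_has_derivative[OF f] by blast
  have "f y = f 0 + D y" for y
  proof -
    obtain a b where ab: "ray_poly f y = [:a, b:]"
      using degree_ray_poly_le[OF f, of y] deg degree1_coeffs
      by (metis degree_eq_zeroE le_less_Suc_eq le_trans One_nat_def less_one linorder_not_le pCons_0_0 order_less_le)
    have ray: "f (t *s y) = a + t * b" for t
      using poly_ray_poly[OF f, of y t] ab by simp
    have "((\<lambda>t::real. t *\<^sub>R y) has_derivative (\<lambda>t. t *\<^sub>R y)) (at 0)"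
      by (auto intro!: derivative_eq_intros)
    moreover have "(f has_derivative D) (at (0 *\<^sub>R y))" using D by simp
    ultimately have "((\<lambda>t::real. f (t *\<^sub>R y)) has_derivative (\<lambda>t. D (t *\<^sub>R y))) (at 0)"
      by (rule has_derivative_compose)
    moreover have "t *\<^sub>R y = of_real t *s y" for t :: real
      by (simp add: vec_eq_iff scaleR_conv_of_real[where ?'a = complex])
    ultimately have "((\<lambda>t::real. a + of_real t * b) has_derivative (\<lambda>t. of_real t * D y)) (at 0)"
      by (simp add: ray hom)
    moreover have "((\<lambda>t::real. a + of_real t * b) has_derivative (\<lambda>t. of_real t * b)) (at 0)"
      by (auto intro!: derivative_eq_intros)
    ultimately have "(\<lambda>t::real. of_real t * D y) = (\<lambda>t. of_real t * b)"
      by (rule has_derivative_unique)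
    then have "D y = b" by (metis mult_1 of_real_1)
    then show ?thesis using ray[of 0] ray[of 1] by simp
  qed
  then show ?thesis using that has_derivative_linear[OF D] hom by blast
qed

section \<open>The degree estimate\<close>

text \<open>The heart of the descent. Which of \<open>P * Q * R\<close> and \<open>R\<^sup>2\<close> can be of top degree depends on the sign of
  \<open>degree P + degree Q - degree R\<close>, and the top degree has to cancel unless it is at most 3. The last polynomial in the
  conclusion is the second root, with \<open>R\<close> itself as the first, of the quadratic equation for \<open>R\<close>.\<close>

lemma cubic_degree_dichotomy:
  fixes P Q R A B K :: "complex poly"
  assumes eq: "P * Q * R - (P + Q + R - A) * (P + Q + R - B) = K"
    and deg: "degree A \<le> 1" "degree B \<le> 1" "degree K \<le> 3"
    and pos: "degree P \<ge> 1" "degree Q \<ge> 1" "degree R \<ge> 1"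
    and max: "degree P \<le> degree R" "degree Q \<le> degree R"
  shows "degree P = 1 \<and> degree Q = 1 \<and> degree R = 1 \<or>
    degree (R + P * Q - (P + Q + R - A) - (P + Q + R - B)) < degree R"
proof (cases "degree P + degree Q > degree R")
  case True
  have nz: "P \<noteq> 0" "Q \<noteq> 0" "R \<noteq> 0" using pos by auto
  then have PQR: "degree (P * Q * R) = degree P + degree Q + degree R"
    by (simp add: degree_mult_eq)
  have "degree (P + Q + R - A) \<le> degree R" "degree (P + Q + R - B) \<le> degree R"
    using deg pos max by (auto intro!: degree_diff_le degree_add_le)
  then have "degree ((P + Q + R - A) * (P + Q + R - B)) \<le> degree R + degree R"
    by (meson add_mono degree_mult_le order_trans)
  then have "degree ((P + Q + R - A) * (P + Q + R - B)) < degree (P * Q * R)"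
    using True PQR by simp
  then have "degree K = degree (P * Q * R)"
    unfolding eq[symmetric] diff_conv_add_uminus by (intro degree_add_eq_left) simp
  then show ?thesis using deg(3) PQR pos by simp
next
  case False
  \<comment> \<open>The terms quadratic in \<open>R\<close> are collected in \<open>R * (P * Q - R)\<close>; everything else has
    degree below \<open>2 * degree R\<close>.\<close>
  define U where "U = P + Q - A"
  define V where "V = P + Q - B"
  have low: "degree P < degree R" "degree Q < degree R" "degree A < degree R" "degree B < degree R"
    "degree K < degree R + degree R"
    using False pos deg by auto
  have UV: "degree U < degree R" "degree V < degree R"
    unfolding U_def V_def using low by (auto intro!: degree_diff_less degree_add_less)
  have prod_less: "degree (X * Y) < degree R + degree R"
    if "degree X \<le> degree R" "degree Y < degree R" for X Y :: "complex poly"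
    using degree_mult_le[of X Y] that by linarith
  have "R * (P * Q - R) = R * (U + V) + U * V + K"
    unfolding eq[symmetric] U_def V_def by (simp add: algebra_simps)
  moreover have "degree (R * (U + V) + U * V + K) < degree R + degree R"
    using UV low by (intro degree_add_less prod_less) auto
  ultimately have "degree (R * (P * Q - R)) < degree R + degree R" by simp
  then have less: "degree (P * Q - R) < degree R"
    using pos by (cases "P * Q - R = 0"; cases "R = 0") (auto simp: degree_mult_eq)
  have regroup: "R + P * Q - (P + Q + R - A) - (P + Q + R - B) = (P * Q - R) - U - V"
    by (simp add: U_def V_def algebra_simps)
  show ?thesis unfolding regroup using less UV
    by (intro disjI2 degree_diff_less[of "P * Q - R - U"] degree_diff_less[of "P * Q - R"])
qed

section \<open>Moves in the group and their action on Markov maps\<close>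

text \<open>Fixing \<open>J\<close>, \<open>J1\<close>, \<open>J2\<close> and the first two coordinates leaves a quadratic equation for the third; this move
  exchanges its roots.\<close>

definition vieta :: "complex ^ 5 \<Rightarrow> complex ^ 5" where
  "vieta = tau1 \<circ> sigma2"

lemma vieta_eq:
  "vieta y = vector [y$1, y$2, y$3 + y$1 * y$2 - y$4 - y$5, y$1 * y$2 - y$5, y$1 * y$2 - y$4]"
  by (simp add: vieta_def tau1_def sigma2_def)

lemma star_Markov_image_id: "id \<in> star_Markov_image"
proof -
  have "\<one>\<^bsub>BijGroup UNIV\<^esub> = (id :: complex ^ 5 \<Rightarrow> complex ^ 5)"
    by (simp add: BijGroup_def fun_eq_iff)
  then show ?thesis
    using generate.one[of "BijGroup UNIV" "{tau1, tau2, sigma1, sigma2}"]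
    by (simp only: star_Markov_image_def)
qed

lemma star_Markov_image_compose:
  assumes "\<phi> \<in> star_Markov_image" "\<psi> \<in> star_Markov_image"
  shows "\<phi> \<circ> \<psi> \<in> star_Markov_image"
proof -
  have "star_Markov_image \<subseteq> carrier (BijGroup UNIV)"
    unfolding star_Markov_image_def
    by (rule group.generate_incl[OF group_BijGroup star_Markov_generators])
  then have "\<phi> \<otimes>\<^bsub>BijGroup UNIV\<^esub> \<psi> = \<phi> \<circ> \<psi>"
    using assms by (auto simp: BijGroup_def compose_def fun_eq_iff)
  then show ?thesis
    using generate.eng[of \<phi> "BijGroup UNIV" "{tau1, tau2, sigma1, sigma2}" \<psi>] assms
    by (simp add: star_Markov_image_def)
qed

lemma move_in_star_Markov_image:
  assumes "\<phi> \<in> {sigma1, sigma2, vieta}"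
  shows "\<phi> \<in> star_Markov_image"
proof -
  have "\<phi> \<in> star_Markov_image" if "\<phi> \<in> {tau1, tau2, sigma1, sigma2}" for \<phi>
    using that unfolding star_Markov_image_def by (rule generate.incl)
  then show ?thesis
    using assms star_Markov_image_compose[of tau1 sigma2] by (auto simp: vieta_def)
qed

lemma move_involution:
  assumes "\<phi> \<in> {sigma1, sigma2, vieta}"
  shows "\<phi> \<circ> \<phi> = id"
  using assms by (auto simp: fun_eq_iff vec_eq_iff forall_5 sigma1_def sigma2_def vieta_eq)

lemma move_polynomial_automorphism:
  assumes "\<phi> \<in> {sigma1, sigma2, vieta}"
  shows "polynomial_automorphism \<phi>"
proof (rule polynomial_automorphism_involution)
  show "polynomial_map \<phi>"
    using assms
    by (auto simp: polynomial_map_def forall_5 sigma1_def sigma2_def vieta_eq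
        intro!: polynomial_fun_diff polynomial_fun_add polynomial_fun_mult)
  show "\<phi> \<circ> \<phi> = id" by (rule move_involution[OF assms])
qed

lemma move_invariants:
  assumes "\<phi> \<in> {sigma1, sigma2, vieta}"
  shows "J \<circ> \<phi> = J" "J1 \<circ> \<phi> = J1" "J2 \<circ> \<phi> = J2"
  using assms
  by (auto simp: fun_eq_iff J_def J1_def J2_def sigma1_def sigma2_def vieta_eq algebra_simps)

text \<open>The hypotheses on \<open>\<psi>\<close> in the form in which they are passed along the descent.\<close>

definition Markov_map :: "(complex ^ 5 \<Rightarrow> complex ^ 5) \<Rightarrow> bool" where
  "Markov_map \<psi> \<longleftrightarrow> polynomial_map \<psi> \<and> interior (range \<psi>) \<noteq> {} \<and>
     J \<circ> \<psi> = J \<and> J1 \<circ> \<psi> = J1 \<and> J2 \<circ> \<psi> = J2"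

definition Markov_automorphism :: "(complex ^ 5 \<Rightarrow> complex ^ 5) \<Rightarrow> bool" where
  "Markov_automorphism \<psi> \<longleftrightarrow> polynomial_automorphism \<psi> \<and> \<psi> \<in> star_Markov_image"

lemma Markov_map_move:
  assumes "Markov_map \<psi>" "\<phi> \<in> {sigma1, sigma2, vieta}"
  shows "Markov_map (\<phi> \<circ> \<psi>)"
  unfolding Markov_map_def
proof (intro conjI)
  show "polynomial_map (\<phi> \<circ> \<psi>)"
    using assms move_polynomial_automorphism
    by (auto simp only: Markov_map_def polynomial_automorphism_def intro: polynomial_map_compose)
  show "interior (range (\<phi> \<circ> \<psi>)) \<noteq> {}"
    by (rule interior_range_compose_homeomorphism[OF _ move_polynomial_automorphism[OF assms(2)]])
      (use assms(1) in \<open>simp add: Markov_map_def\<close>)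
qed (use assms move_invariants[OF assms(2)] in \<open>simp_all only: Markov_map_def comp_assoc[symmetric]\<close>)

text \<open>The moves are involutions, so a map is recovered from its image under a move by repeating that move.\<close>

lemma Markov_automorphism_move:
  assumes "Markov_automorphism (\<phi> \<circ> \<psi>)" "\<phi> \<in> {sigma1, sigma2, vieta}"
  shows "Markov_automorphism \<psi>"
proof -
  have "\<phi> \<circ> (\<phi> \<circ> \<psi>) = \<psi>"
    by (simp only: comp_assoc[symmetric] move_involution[OF assms(2)] id_comp)
  then show ?thesis
    using polynomial_automorphism_compose[OF move_polynomial_automorphism[OF assms(2)], of "\<phi> \<circ> \<psi>"]
      star_Markov_image_compose[OF move_in_star_Markov_image[OF assms(2)], of "\<phi> \<circ> \<psi>"] assms(1)
    by (simp add: Markov_automorphism_def)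
qed

lemma Markov_map_component:
  assumes "Markov_map \<psi>"
  shows "polynomial_fun (\<lambda>y. \<psi> y $ i)" "\<not> (\<forall>y. \<psi> y $ i = k)" "total_degree (\<lambda>y. \<psi> y $ i) \<ge> 1"
proof -
  show pf: "polynomial_fun (\<lambda>y. \<psi> y $ i)"
    using assms by (simp add: Markov_map_def polynomial_map_def)
  show nc: "\<not> (\<forall>y. \<psi> y $ i = k)" for k
    using assms interior_range_component_nonconstant[of \<psi> i k] by (simp add: Markov_map_def)
  show "total_degree (\<lambda>y. \<psi> y $ i) \<ge> 1"
    using total_degree_0_imp_constant[OF pf] nc by (metis less_one linorder_not_le)
qed

lemma Markov_map_equations:
  assumes "Markov_map \<psi>"
  shows "\<psi> y $ 4 = \<psi> y $ 1 + \<psi> y $ 2 + \<psi> y $ 3 - J1 y"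
    "\<psi> y $ 5 = \<psi> y $ 1 + \<psi> y $ 2 + \<psi> y $ 3 - J2 y"
    "\<psi> y $ 1 * \<psi> y $ 2 * \<psi> y $ 3 - \<psi> y $ 4 * \<psi> y $ 5 = J y"
proof -
  have "J (\<psi> y) = J y" "J1 (\<psi> y) = J1 y" "J2 (\<psi> y) = J2 y"
    using assms by (auto simp: Markov_map_def fun_eq_iff)
  then have "\<psi> y $ 1 + \<psi> y $ 2 + \<psi> y $ 3 - \<psi> y $ 4 = J1 y"
    "\<psi> y $ 1 + \<psi> y $ 2 + \<psi> y $ 3 - \<psi> y $ 5 = J2 y"
    and "\<psi> y $ 1 * \<psi> y $ 2 * \<psi> y $ 3 - \<psi> y $ 4 * \<psi> y $ 5 = J y"
    by (simp_all only: J_def[of "\<psi> y"] J1_def[of "\<psi> y"] J2_def[of "\<psi> y"])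
  then show "\<psi> y $ 4 = \<psi> y $ 1 + \<psi> y $ 2 + \<psi> y $ 3 - J1 y"
    "\<psi> y $ 5 = \<psi> y $ 1 + \<psi> y $ 2 + \<psi> y $ 3 - J2 y"
    "\<psi> y $ 1 * \<psi> y $ 2 * \<psi> y $ 3 - \<psi> y $ 4 * \<psi> y $ 5 = J y"
    by (simp_all add: algebra_simps)
qed

text \<open>A multiset, so that permuting components leaves it unchanged.\<close>

definition component_degrees :: "(complex ^ 5 \<Rightarrow> complex ^ 5) \<Rightarrow> nat multiset" where
  "component_degrees \<psi> = {#total_degree (\<lambda>y. \<psi> y $ 1), total_degree (\<lambda>y. \<psi> y $ 2),
     total_degree (\<lambda>y. \<psi> y $ 3)#}"

lemma Markov_map_bring_to_third:
  assumes "Markov_map \<psi>" "k \<in> {1, 2, 3}"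
  obtains \<theta> where "Markov_map \<theta>" "Markov_automorphism \<theta> \<Longrightarrow> Markov_automorphism \<psi>"
    "\<And>y. \<theta> y $ 3 = \<psi> y $ k" "component_degrees \<theta> = component_degrees \<psi>"
proof -
  consider "k = 1" | "k = 2" | "k = 3" using assms(2) by blast
  then show ?thesis
  proof cases
    case 1
    show ?thesis
    proof (rule that[of "sigma2 \<circ> (sigma1 \<circ> \<psi>)"])
      show "Markov_map (sigma2 \<circ> (sigma1 \<circ> \<psi>))"
        by (intro Markov_map_move assms) auto
      show "Markov_automorphism \<psi>" if "Markov_automorphism (sigma2 \<circ> (sigma1 \<circ> \<psi>))"
        by (rule Markov_automorphism_move, rule Markov_automorphism_move, rule that) auto
    qed (simp_all add: 1 sigma1_def sigma2_def component_degrees_def add_mset_commute)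
  next
    case 2
    show ?thesis
    proof (rule that[of "sigma2 \<circ> \<psi>"])
      show "Markov_map (sigma2 \<circ> \<psi>)"
        by (intro Markov_map_move assms) auto
      show "Markov_automorphism \<psi>" if "Markov_automorphism (sigma2 \<circ> \<psi>)"
        by (rule Markov_automorphism_move, rule that) auto
    qed (simp_all add: 2 sigma2_def component_degrees_def add_mset_commute)
  next
    case 3
    show ?thesis using that[of \<psi>] assms 3 by simp
  qed
qed

section \<open>The exchange of roots lowers the degree\<close>

text \<open>The univariate estimate applies on every line; choosing one on which the three components and the new third
  component all attain their total degrees turns it into a statement about total degrees.\<close>

lemma vieta_lowers_degree:
  assumes "Markov_map \<psi>"
    and le: "total_degree (\<lambda>y. \<psi> y $ 1) \<le> total_degree (\<lambda>y. \<psi> y $ 3)"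
      "total_degree (\<lambda>y. \<psi> y $ 2) \<le> total_degree (\<lambda>y. \<psi> y $ 3)"
  shows "component_degrees \<psi> = {#1, 1, 1#} \<or>
    total_degree (\<lambda>y. vieta (\<psi> y) $ 3) < total_degree (\<lambda>y. \<psi> y $ 3)"
proof -
  note comp = Markov_map_component[OF assms(1)]
  have v: "polynomial_fun (\<lambda>y. vieta (\<psi> y) $ 3)"
    using Markov_map_component(1)[OF Markov_map_move[OF assms(1), of vieta]] by simp
  obtain y where y: "\<And>f. f \<in> {\<lambda>y. \<psi> y $ 1, \<lambda>y. \<psi> y $ 2, \<lambda>y. \<psi> y $ 3, \<lambda>y. vieta (\<psi> y) $ 3} \<Longrightarrow>
      degree (ray_poly f y) = total_degree f"
    by (rule total_degree_attained_simultaneously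
        [of "{\<lambda>y. \<psi> y $ 1, \<lambda>y. \<psi> y $ 2, \<lambda>y. \<psi> y $ 3, \<lambda>y. vieta (\<psi> y) $ 3}"]) (use comp v in auto)
  define P Q R where "P = ray_poly (\<lambda>y. \<psi> y $ 1) y" and "Q = ray_poly (\<lambda>y. \<psi> y $ 2) y"
    and "R = ray_poly (\<lambda>y. \<psi> y $ 3) y"
  define A B where "A = [:0, J1 y:]" and "B = [:0, J2 y:]"
  have P: "poly P t = \<psi> (t *s y) $ 1" and Q: "poly Q t = \<psi> (t *s y) $ 2"
    and R: "poly R t = \<psi> (t *s y) $ 3" for t
    by (auto simp: P_def Q_def R_def poly_ray_poly comp)
  have A: "poly A t = J1 (t *s y)" and B: "poly B t = J2 (t *s y)" for t
    by (auto simp: A_def B_def J1_def J2_def algebra_simps)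
  define V W where "V = P + Q + R - A" and "W = P + Q + R - B"
  have V: "poly V t = \<psi> (t *s y) $ 4" and W: "poly W t = \<psi> (t *s y) $ 5" for t
    by (simp_all add: V_def W_def P Q R A B Markov_map_equations(1,2)[OF assms(1)])
  have degs: "degree P = total_degree (\<lambda>y. \<psi> y $ 1)" "degree Q = total_degree (\<lambda>y. \<psi> y $ 2)"
    "degree R = total_degree (\<lambda>y. \<psi> y $ 3)"
    unfolding P_def Q_def R_def by (rule y, simp)+
  have "ray_poly (\<lambda>y. vieta (\<psi> y) $ 3) y = R + P * Q - V - W"
    by (rule ray_poly_eqI) (simp add: vieta_eq P Q R V W)
  then have vieta_deg: "total_degree (\<lambda>y. vieta (\<psi> y) $ 3) = degree (R + P * Q - V - W)"
    using y[of "\<lambda>y. vieta (\<psi> y) $ 3"] by simp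
  have "P * Q * R - V * W = [:0, 0, - (y$4 * y$5), y$1 * y$2 * y$3:]"
  proof (rule poly_eqI_all)
    fix t
    have "poly (P * Q * R - V * W) t = J (t *s y)"
      by (simp add: V W P Q R Markov_map_equations(3)[OF assms(1)])
    also have "\<dots> = poly [:0, 0, - (y$4 * y$5), y$1 * y$2 * y$3:] t"
      by (simp add: J_def algebra_simps)
    finally show "poly (P * Q * R - V * W) t = poly [:0, 0, - (y$4 * y$5), y$1 * y$2 * y$3:] t" .
  qed
  then have "degree P = 1 \<and> degree Q = 1 \<and> degree R = 1 \<or> degree (R + P * Q - V - W) < degree R"
    unfolding V_def W_def
    by (rule cubic_degree_dichotomy)
      (use degs comp(3) le in \<open>auto simp: A_def B_def degree_pCons_eq_if\<close>)
  then show ?thesis by (auto simp: degs vieta_deg component_degrees_def)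
qed

section \<open>Affine maps\<close>

text \<open>The cubic terms of the equation say that the linear parts of the three components multiply to
  \<open>y\<^sub>1 y\<^sub>2 y\<^sub>3\<close>. On the hyperplane \<open>y\<^sub>i = 0\<close> the product vanishes, hence so does one of the factors, which is
  therefore a multiple of \<open>y\<^sub>i\<close>.\<close>

lemma affine_Markov_map_component:
  assumes \<psi>: "Markov_map \<psi>" and deg: "component_degrees \<psi> = {#1, 1, 1#}" and i: "i \<in> {1, 2, 3}"
  obtains k c a where "k \<in> {1, 2, 3}" "\<And>y. \<psi> y $ k = c + a * y $ i"
proof -
  note comp = Markov_map_component[OF \<psi>]
  have "set_mset (component_degrees \<psi>) = {1}" using deg by simp
  then have "total_degree (\<lambda>y. \<psi> y $ k) \<le> 1" if "k \<in> {1, 2, 3}" for k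
    using that by (auto simp: component_degrees_def)
  then have "\<exists>D. linear D \<and> (\<forall>c h. D (c *s h) = c * D h) \<and> (\<forall>y. \<psi> y $ k = \<psi> 0 $ k + D y)"
    if "k \<in> {1, 2, 3}" for k
    by (rule total_degree_le_1_imp_affine[OF comp(1)[of k]]) (use that in blast)+
  then have "\<forall>k\<in>{1, 2, 3}. \<exists>D. linear D \<and> (\<forall>c h. D (c *s h) = c * D h) \<and>
      (\<forall>y. \<psi> y $ k = \<psi> 0 $ k + D y)"
    by (rule ballI)
  from bchoice[OF this] obtain D where D_all: "\<forall>k\<in>{1, 2, 3}. linear (D k) \<and>
      (\<forall>c h. D k (c *s h) = c * D k h) \<and> (\<forall>y. \<psi> y $ k = \<psi> 0 $ k + D k y)"
    by (rule exE)
  have linear: "linear (D k)" and hom: "D k (c *s h) = c * D k h"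
    and D: "\<psi> y $ k = \<psi> 0 $ k + D k y" if "k \<in> {1, 2, 3}" for k c h y
    using bspec[OF D_all that] by blast+
  have cubic: "D 1 y * D 2 y * D 3 y = y $ 1 * y $ 2 * y $ 3" for y
  proof -
    let ?s = "\<psi> 0 $ 1 + \<psi> 0 $ 2 + \<psi> 0 $ 3" and ?S = "D 1 y + D 2 y + D 3 y"
    let ?p = "[:\<psi> 0 $ 1, D 1 y:] * [:\<psi> 0 $ 2, D 2 y:] * [:\<psi> 0 $ 3, D 3 y:]
        - [:?s, ?S - J1 y:] * [:?s, ?S - J2 y:]"
    have "?p = [:0, 0, - (y$4 * y$5), y$1 * y$2 * y$3:]"
    proof (rule poly_eqI_all)
      fix t
      have lin: "poly [:a, b:] t = a + t * b" for a b :: complex by simp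
      have "J1 (t *s y) = t * J1 y" "J2 (t *s y) = t * J2 y"
        by (simp_all add: J1_def J2_def algebra_simps)
      moreover have low: "\<psi> (t *s y) $ k = \<psi> 0 $ k + t * D k y" if "k \<in> {1, 2, 3}" for k
        by (simp only: D[OF that, of "t *s y"] hom[OF that])
      ultimately have "\<psi> (t *s y) $ 4 = ?s + t * (?S - J1 y)" "\<psi> (t *s y) $ 5 = ?s + t * (?S - J2 y)"
        by (simp_all add: Markov_map_equations(1,2)[OF \<psi>] algebra_simps)
      then have "poly ?p t = \<psi> (t *s y) $ 1 * \<psi> (t *s y) $ 2 * \<psi> (t *s y) $ 3
          - \<psi> (t *s y) $ 4 * \<psi> (t *s y) $ 5"
        using low[of 1] low[of 2] low[of 3] by (simp only: poly_diff poly_mult lin) simp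
      also have "\<dots> = J (t *s y)" by (rule Markov_map_equations(3)[OF \<psi>])
      also have "\<dots> = poly [:0, 0, - (y$4 * y$5), y$1 * y$2 * y$3:] t"
        by (simp add: J_def algebra_simps)
      finally show "poly ?p t = poly [:0, 0, - (y$4 * y$5), y$1 * y$2 * y$3:] t" .
    qed
    then have "coeff ?p 3 = coeff [:0, 0, - (y$4 * y$5), y$1 * y$2 * y$3:] 3" by (rule arg_cong)
    then show ?thesis by (simp add: numeral_3_eq_3 algebra_simps)
  qed
  \<comment> \<open>The projection onto the hyperplane.\<close>
  define \<pi> :: "complex ^ 5 \<Rightarrow> complex ^ 5" where "\<pi> y = (\<chi> j. if j = i then 0 else y $ j)" for y
  have "polynomial_fun (\<lambda>y. \<pi> y $ j)" for j
    by (cases "j = i") (auto simp: \<pi>_def)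
  then have \<pi>: "polynomial_map \<pi>" by (simp add: polynomial_map_def)
  have pf: "polynomial_fun (\<lambda>y. D k (\<pi> y))" if "k \<in> {1, 2, 3}" for k
  proof -
    have "D k y = \<psi> y $ k - \<psi> 0 $ k" for y using D[OF that, of y] by simp
    then have "D k = (\<lambda>y. \<psi> y $ k - \<psi> 0 $ k)" by (rule ext)
    then have "polynomial_fun (D k)" using comp(1)[of k] by auto
    then show ?thesis by (rule polynomial_fun_compose[OF _ \<pi>])
  qed
  have "D 1 (\<pi> y) * D 2 (\<pi> y) * D 3 (\<pi> y) = 0" for y
    using i by (auto simp: cubic \<pi>_def)
  then have "\<not> (\<exists>y. \<forall>f\<in>(\<lambda>k y. D k (\<pi> y)) ` {1, 2, 3}. f y \<noteq> 0)" by simp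
  then obtain k where k: "k \<in> {1, 2, 3}" and zero: "\<And>y. D k (\<pi> y) = 0"
    using polynomial_fun_common_nonzero[of "(\<lambda>k y. D k (\<pi> y)) ` {1, 2, 3}"] pf by blast
  have "\<psi> y $ k = \<psi> 0 $ k + D k (axis i 1) * y $ i" for y
  proof -
    have "y = \<pi> y + y $ i *s axis i 1" by (simp add: vec_eq_iff \<pi>_def axis_def)
    then have "D k y = D k (\<pi> y + y $ i *s axis i 1)" by simp
    also have "\<dots> = D k (\<pi> y) + D k (y $ i *s axis i 1)" by (rule linear_add[OF linear[OF k]])
    finally show ?thesis using D[OF k, of y] by (simp add: hom[OF k] zero mult.commute)
  qed
  then show ?thesis using that k by blast
qed

text \<open>Here \<open>u\<close>, the change of \<open>y\<^sub>1 + y\<^sub>2 + y\<^sub>3\<close>, does not involve \<open>y\<^sub>4\<close> and \<open>y\<^sub>5\<close>. Varying \<open>y\<^sub>4\<close> alone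
  forces \<open>u = 0\<close>, so all slopes are 1; then the translations are killed by the zeros of \<open>y\<^sub>1 y\<^sub>2 y\<^sub>3\<close>.\<close>

lemma diagonal_Markov_map_id:
  assumes \<psi>: "Markov_map \<psi>"
    and diag: "\<And>y. \<psi> y $ 1 = p + a * y $ 1" "\<And>y. \<psi> y $ 2 = q + b * y $ 2"
      "\<And>y. \<psi> y $ 3 = r + c * y $ 3"
  shows "\<psi> = id"
proof -
  define u where "u x y z = (p + a * x) + (q + b * y) + (r + c * z) - (x + y + z)" for x y z
  have eq: "(p + a * x) * (q + b * y) * (r + c * z) - (u x y z + v) * (u x y z + w) = x * y * z - v * w"
    for x y z v w
  proof -
    let ?y = "vector [x, y, z, v, w] :: complex ^ 5"
    have "\<psi> ?y $ 4 = u x y z + v" "\<psi> ?y $ 5 = u x y z + w"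
      using Markov_map_equations(1,2)[OF \<psi>, of ?y] by (simp_all add: diag J1_def J2_def u_def)
    then show ?thesis
      using Markov_map_equations(3)[OF \<psi>, of ?y] by (simp only: diag J_def vector_5)
  qed
  have u: "u x y z = 0" for x y z
    using eq[of x y z 1 0] eq[of x y z 0 0] by (simp add: algebra_simps)
  have sum: "p + q + r = 0" using u[of 0 0 0] by (simp add: u_def algebra_simps)
  have abc: "a = 1" "b = 1" "c = 1"
    using u[of 1 0 0] u[of 0 1 0] u[of 0 0 1] sum by (auto simp: u_def algebra_simps)
  have prod: "(p + x) * (q + y) * (r + z) = x * y * z" for x y z
    using eq[of x y z 0 0] by (simp add: u abc)
  have pqr: "p = 0" "q = 0" "r = 0"
    using prod[of "-p" 1 1] prod[of 1 "-q" 1] prod[of 1 1 "-r"] by auto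
  show ?thesis
    using Markov_map_equations(1,2)[OF \<psi>]
    by (auto simp: fun_eq_iff vec_eq_iff forall_5 diag pqr abc J1_def J2_def)
qed

text \<open>Different coordinates belong to different components, since a component that depends only on
  \<open>y\<^sub>i\<close> and also only on \<open>y\<^sub>j\<close> is constant. So the components can be sorted, beginning with the third.\<close>

lemma affine_Markov_map_automorphism:
  assumes "Markov_map \<psi>" "component_degrees \<psi> = {#1, 1, 1#}"
  shows "Markov_automorphism \<psi>"
proof -
  have distinct: False
    if "Markov_map \<theta>" "i \<noteq> j" "\<And>y. \<theta> y $ k = c + a * y $ i" "\<And>y. \<theta> y $ k = d + b * y $ j"
    for \<theta> :: "complex ^ 5 \<Rightarrow> complex ^ 5" and i j k :: 5 and a b c d
  proof -
    have "c + a * t = d" for t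
      using that(3)[of "axis i t"] that(4)[of "axis i t"] that(2) by (simp add: axis_def)
    then have "\<theta> y $ k = d" for y using that(3) by simp
    then show False using Markov_map_component(2)[OF that(1)] by blast
  qed
  obtain k c a where k: "k \<in> {1, 2, 3}" and three: "\<And>y. \<psi> y $ k = c + a * y $ 3"
    using affine_Markov_map_component[OF assms, of 3] by auto
  obtain \<theta> where \<theta>: "Markov_map \<theta>" "component_degrees \<theta> = {#1, 1, 1#}"
    and \<theta>\<psi>: "Markov_automorphism \<theta> \<Longrightarrow> Markov_automorphism \<psi>"
    and \<theta>3: "\<And>y. \<theta> y $ 3 = c + a * y $ 3"
    using Markov_map_bring_to_third[OF assms(1) k] assms(2) three by metis
  obtain l d b where l: "l \<in> {1, 2, 3}" and two: "\<And>y. \<theta> y $ l = d + b * y $ 2"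
    using affine_Markov_map_component[OF \<theta>, of 2] by auto
  have "l \<noteq> 3" using distinct[OF \<theta>(1) _ \<theta>3, of 2] two by auto
  define \<omega> where "\<omega> = (if l = 2 then \<theta> else sigma1 \<circ> \<theta>)"
  have \<omega>: "Markov_map \<omega>"
    using \<theta>(1) Markov_map_move[of \<theta> sigma1] by (simp add: \<omega>_def)
  have \<omega>deg: "component_degrees \<omega> = {#1, 1, 1#}"
    using \<theta>(2) by (auto simp: \<omega>_def component_degrees_def sigma1_def add_mset_commute)
  have \<omega>\<theta>: "Markov_automorphism \<omega> \<Longrightarrow> Markov_automorphism \<theta>"
    using Markov_automorphism_move[of sigma1 \<theta>] by (auto simp: \<omega>_def split: if_splits)
  have \<omega>3: "\<omega> y $ 3 = c + a * y $ 3" and \<omega>2: "\<omega> y $ 2 = d + b * y $ 2" for y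
    using \<theta>3 two l \<open>l \<noteq> 3\<close> by (auto simp: \<omega>_def sigma1_def)
  obtain m e f where m: "m \<in> {1, 2, 3}" and one: "\<And>y. \<omega> y $ m = e + f * y $ 1"
    using affine_Markov_map_component[OF \<omega> \<omega>deg, of 1] by auto
  have "m \<noteq> 3" using distinct[OF \<omega> _ \<omega>3, of 1] one by auto
  moreover have "m \<noteq> 2" using distinct[OF \<omega> _ \<omega>2, of 1] one by auto
  ultimately have "\<omega> = id"
    using diagonal_Markov_map_id[OF \<omega> _ \<omega>2 \<omega>3] m one by auto
  then have "Markov_automorphism \<omega>"
    using polynomial_automorphism_involution[of "id :: complex ^ 5 \<Rightarrow> complex ^ 5"] star_Markov_image_id
    by (auto simp: Markov_automorphism_def polynomial_map_def)
  then show ?thesis using \<omega>\<theta> \<theta>\<psi> by blast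
qed

section \<open>Induction on the sum of the degrees\<close>

lemma Markov_map_automorphism:
  assumes "Markov_map \<psi>"
  shows "Markov_automorphism \<psi>"
  using assms
proof (induction "sum_mset (component_degrees \<psi>)" arbitrary: \<psi> rule: less_induct)
  case less
  let ?d = "\<lambda>k. total_degree (\<lambda>y. \<psi> y $ k)"
  have "Max (?d ` {1, 2, 3}) \<in> ?d ` {1, 2, 3}" by (rule Max_in) auto
  then obtain k where k: "k \<in> {1, 2, 3}" and k_max: "Max (?d ` {1, 2, 3}) = ?d k"
    by (rule imageE)
  have max: "?d j \<le> ?d k" if "j \<in> {1, 2, 3}" for j
    unfolding k_max[symmetric] using that by (intro Max_ge) auto
  obtain \<theta> where \<theta>: "Markov_map \<theta>" "component_degrees \<theta> = component_degrees \<psi>"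
    and \<theta>\<psi>: "Markov_automorphism \<theta> \<Longrightarrow> Markov_automorphism \<psi>"
    and \<theta>3: "\<And>y. \<theta> y $ 3 = \<psi> y $ k"
    using Markov_map_bring_to_third[OF less.prems k] by metis
  let ?e = "\<lambda>k. total_degree (\<lambda>y. \<theta> y $ k)"
  have "set_mset (component_degrees \<theta>) \<subseteq> {..?d k}"
    unfolding \<theta>(2) using max by (auto simp: component_degrees_def)
  then have "?e 1 \<le> ?e 3" "?e 2 \<le> ?e 3"
    by (auto simp: component_degrees_def \<theta>3)
  then consider "component_degrees \<theta> = {#1, 1, 1#}" | "total_degree (\<lambda>y. vieta (\<theta> y) $ 3) < ?e 3"
    using vieta_lowers_degree[OF \<theta>(1)] by blast
  then show ?case
  proof cases
    case 1
    then show ?thesis using affine_Markov_map_automorphism \<theta> \<theta>\<psi> by blast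
  next
    case 2
    have "sum_mset (component_degrees (vieta \<circ> \<theta>)) < sum_mset (component_degrees \<theta>)"
      using 2 by (simp add: component_degrees_def vieta_eq)
    then have "Markov_automorphism (vieta \<circ> \<theta>)"
      using less.hyps[of "vieta \<circ> \<theta>"] Markov_map_move[OF \<theta>(1)] \<theta>(2) by simp
    then show ?thesis using Markov_automorphism_move \<theta>\<psi> by blast
  qed
qed

theorem theorem12p6:
  fixes \<psi> :: "complex ^ 5 \<Rightarrow> complex ^ 5"
  assumes "polynomial_map \<psi>"
    and "maximal_rank \<psi>"
    and "J \<circ> \<psi> = J"
    and "J1 \<circ> \<psi> = J1"
    and "J2 \<circ> \<psi> = J2"
  shows "polynomial_automorphism \<psi> \<and> \<psi> \<in> star_Markov_image"
proof -
  have "Markov_map \<psi>"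
    using assms maximal_rank_interior_range by (simp add: Markov_map_def)
  then show ?thesis
    using Markov_map_automorphism by (simp add: Markov_automorphism_def)
qed

end
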